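(* Let $G$ be a prime tournament. Then $G$ is both $T_5$-free and $U_5$-free if and only if $V(G)$ can be partitioned into sets $X$, $Y$, $Z$ (some possibly empty) such that $X \cup Y$, $Y \cup Z$, and $Z \cup X$ are each transitive.
   Context: A tournament is a finite loopless directed graph in which for any two distinct vertices $u,v$ there is exactly one edge between them; write $u \rightarrow v$ for the edge from $u$ to $v$. For tournaments $G,H$, $G$ is $H$-free if no induced subtournament of $G$ is isomorphic to $H$. A set $S \subseteq V(G)$ is transitive if the induced subtournament has no cyclic triangle (three vertices $a\rightarrow b\rightarrow c\rightarrow a$). A homogeneous set of $G$ is a set $X \subseteq V(G)$ such that every $v \in V(G)\setminus X$ satisfies either $v \rightarrow x$ for all $x \in X$ or $x \rightarrow v$ for all $x \in X$; it is nontrivial if $1<|X|<|V(G)|$. $G$ is prime if it has no nontrivial homogeneous set. $T_5$ is the tournament on $v_1,\dots,v_5$ with $v_i \rightarrow v_j$ iff $j-i \equiv 1,2 \pmod 5$. $U_5$ is the tournament on $v_1,\dots,v_5$ with $v_2 \rightarrow v_1$, and $v_i \rightarrow v_j$ whenever $j-i\equiv 1,2 \pmod 5$ and $\{i,j\}\neq\{1,2\}$. *)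

theory Defs
  imports "Graph_Theory.Digraph_Isomorphism" "HOL-Number_Theory.Cong"
begin

text \<open>A \<^locale>\<open>digraph\<close> is finite, loopless and has no parallel arcs, so that the condition below
  says that there is exactly one arc between any two distinct vertices.\<close>

locale tournament = digraph +
  assumes exactly_one_arc:
    "\<lbrakk>u \<in> verts G; v \<in> verts G; u \<noteq> v\<rbrakk> \<Longrightarrow> (u \<rightarrow>\<^bsub>G\<^esub> v) \<noteq> (v \<rightarrow>\<^bsub>G\<^esub> u)"

definition free_of :: "('c, 'd) pre_digraph \<Rightarrow> ('a, 'b) pre_digraph \<Rightarrow> bool" where
  "free_of H G \<longleftrightarrow> \<not> (\<exists>G'. induced_subgraph G' G \<and> digraph_iso G' H)"

definition transitive_set :: "('a, 'b) pre_digraph \<Rightarrow> 'a set \<Rightarrow> bool" where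
  "transitive_set G S \<longleftrightarrow> S \<subseteq> verts G \<and>
     \<not> (\<exists>a b c. a \<rightarrow>\<^bsub>G \<restriction> S\<^esub> b \<and> b \<rightarrow>\<^bsub>G \<restriction> S\<^esub> c \<and> c \<rightarrow>\<^bsub>G \<restriction> S\<^esub> a)"

definition homogeneous_set :: "('a, 'b) pre_digraph \<Rightarrow> 'a set \<Rightarrow> bool" where
  "homogeneous_set G X \<longleftrightarrow> X \<subseteq> verts G \<and>
     (\<forall>v \<in> verts G - X. (\<forall>x \<in> X. v \<rightarrow>\<^bsub>G\<^esub> x) \<or> (\<forall>x \<in> X. x \<rightarrow>\<^bsub>G\<^esub> v))"

definition nontrivial_homogeneous_set :: "('a, 'b) pre_digraph \<Rightarrow> 'a set \<Rightarrow> bool" where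
  "nontrivial_homogeneous_set G X \<longleftrightarrow>
     homogeneous_set G X \<and> 1 < card X \<and> card X < card (verts G)"

definition prime_tournament :: "('a, 'b) pre_digraph \<Rightarrow> bool" where
  "prime_tournament G \<longleftrightarrow> tournament G \<and> \<not> (\<exists>X. nontrivial_homogeneous_set G X)"

text \<open>The vertex $v_i$ is represented by the integer $i$, so that $j - i$ is not truncated.\<close>

definition T5 :: "(int, int \<times> int) pre_digraph" where
  "T5 = with_proj \<lparr> pverts = {1..5},
     parcs = {(i, j). i \<in> {1..5} \<and> j \<in> {1..5} \<and> ([j - i = 1] (mod 5) \<or> [j - i = 2] (mod 5))} \<rparr>"

definition U5 :: "(int, int \<times> int) pre_digraph" where
  "U5 = with_proj \<lparr> pverts = {1..5},
     parcs = insert (2, 1)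
       {(i, j). i \<in> {1..5} \<and> j \<in> {1..5} \<and> ([j - i = 1] (mod 5) \<or> [j - i = 2] (mod 5)) \<and>
          {i, j} \<noteq> {1, 2}} \<rparr>"

lemma tournament_with_proj:
  assumes "finite V" and "A \<subseteq> V \<times> V" and "irrefl A"
    and "\<forall>u \<in> V. \<forall>v \<in> V. u \<noteq> v \<longrightarrow> ((u, v) \<in> A) \<noteq> ((v, u) \<in> A)"
  shows "tournament (with_proj \<lparr> pverts = V, parcs = A \<rparr>)"
proof -
  let ?G = "with_proj \<lparr> pverts = V, parcs = A \<rparr>"
  have "finite A"
    using assms(1,2) by (meson finite_SigmaI finite_subset)
  show ?thesis
  proof
    fix e assume e: "e \<in> arcs ?G"
    show "tail ?G e \<in> verts ?G" "head ?G e \<in> verts ?G"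
      using e assms(2) by auto
    show "tail ?G e \<noteq> head ?G e"
      using e assms(3) by (cases e) (auto simp: irrefl_def)
  next
    show "finite (verts ?G)" "finite (arcs ?G)"
      using assms(1) \<open>finite A\<close> by simp_all
  next
    fix e1 e2 assume "arc_to_ends ?G e1 = arc_to_ends ?G e2"
    then show "e1 = e2"
      by (simp add: arc_to_ends_def prod_eq_iff)
  next
    fix u v assume "u \<in> verts ?G" "v \<in> verts ?G" "u \<noteq> v"
    then show "(u \<rightarrow>\<^bsub>?G\<^esub> v) \<noteq> (v \<rightarrow>\<^bsub>?G\<^esub> u)"
      unfolding with_proj_simps pair_pre_digraph.simps using assms(4) by blast
  qed
qed

lemma atLeastAtMost_1_5: "{1..5} = {1, 2, 3, 4, 5 :: int}"
  by auto

lemma tournament_T5: "tournament T5"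
  unfolding T5_def
proof (rule tournament_with_proj)
  let ?A = "{(i, j). i \<in> {1..5 :: int} \<and> j \<in> {1..5} \<and>
    ([j - i = 1] (mod 5) \<or> [j - i = 2] (mod 5))}"
  show "finite {1..5 :: int}" "?A \<subseteq> {1..5} \<times> {1..5}" "irrefl ?A"
    by (auto simp: irrefl_def cong_def)
  show "\<forall>u \<in> {1..5}. \<forall>v \<in> {1..5}. u \<noteq> v \<longrightarrow> ((u, v) \<in> ?A) \<noteq> ((v, u) \<in> ?A)"
    unfolding atLeastAtMost_1_5 by (simp add: cong_def)
qed

lemma tournament_U5: "tournament U5"
  unfolding U5_def
proof (rule tournament_with_proj)
  let ?A = "insert (2, 1) {(i, j). i \<in> {1..5 :: int} \<and> j \<in> {1..5} \<and>
    ([j - i = 1] (mod 5) \<or> [j - i = 2] (mod 5)) \<and> {i, j} \<noteq> {1, 2}}"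
  show "finite {1..5 :: int}" "?A \<subseteq> {1..5} \<times> {1..5}" "irrefl ?A"
    by (auto simp: irrefl_def cong_def)
  show "\<forall>u \<in> {1..5}. \<forall>v \<in> {1..5}. u \<noteq> v \<longrightarrow> ((u, v) \<in> ?A) \<noteq> ((v, u) \<in> ?A)"
    unfolding atLeastAtMost_1_5 by (simp add: cong_def doubleton_eq_iff)
qed

end

theory Submission
  imports Defs
begin

text \<open>
  A partition as in the theorem is the same as a 3-colouring in which every cyclic triangle is
  rainbow, and \<open>T5\<close> and \<open>U5\<close> differ only in the orientation of one arc whose removal already rules
  out such a colouring. For the converse, take a maximal strongly connected set \<open>S\<close> that has a rainbow
  colouring. If a vertex \<open>v\<close> outside \<open>S\<close> has both in- and out-neighbours in \<open>S\<close>, the colouring extends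
  to \<open>v\<close>: two triangles through \<open>v\<close> that force different colours on \<open>v\<close> are joined by a shortest path
  in \<open>S\<close>, near which one finds a copy of \<open>T5\<close>, of \<open>U5\<close>, or of a cyclic triangle with one vertex blown
  up to a cyclic triangle. The last is impossible in a prime tournament without \<open>T5\<close> and \<open>U5\<close>. So \<open>S\<close> is
  homogeneous, hence everything.
\<close>

section \<open>Rainbow colourings and strongly connected sets\<close>

text \<open>This is \<open>T5\<close> with the arc between $v_1$ and $v_2$ left unspecified; \<open>p, q, r, s, t\<close> stand for
  $v_3, v_4, v_5, v_1, v_2$.\<close>

definition near_T5 :: "('a \<Rightarrow> 'a \<Rightarrow> bool) \<Rightarrow> 'a \<Rightarrow> 'a \<Rightarrow> 'a \<Rightarrow> 'a \<Rightarrow> 'a \<Rightarrow> bool" where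
  "near_T5 E p q r s t \<longleftrightarrow> E p q \<and> E q r \<and> E p r \<and> E s p \<and> E q s \<and> E r s \<and> E t p \<and> E t q \<and> E r t"

text \<open>A cyclic triangle on \<open>d\<close>, \<open>e\<close> and a third vertex, with the
  third vertex replaced by the cyclic triangle \<open>a b c\<close>.\<close>

definition blown_triangle :: "('a \<Rightarrow> 'a \<Rightarrow> bool) \<Rightarrow> 'a \<Rightarrow> 'a \<Rightarrow> 'a \<Rightarrow> 'a \<Rightarrow> 'a \<Rightarrow> bool" where
  "blown_triangle E a b c d e \<longleftrightarrow> E a b \<and> E b c \<and> E c a \<and> E d e \<and>
     E a d \<and> E b d \<and> E c d \<and> E e a \<and> E e b \<and> E e c"

text \<open>Values outside \<open>S\<close> are unconstrained, so a colouring extends to a new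
  vertex by a function update.\<close>

definition rainbow :: "('a \<Rightarrow> 'a \<Rightarrow> bool) \<Rightarrow> 'a set \<Rightarrow> ('a \<Rightarrow> nat) \<Rightarrow> bool" where
  "rainbow E S col \<longleftrightarrow> (\<forall>a\<in>S. col a < 3) \<and>
     (\<forall>a\<in>S. \<forall>b\<in>S. \<forall>c\<in>S. E a b \<and> E b c \<and> E c a \<longrightarrow> distinct [col a, col b, col c])"

text \<open>Walks have to stay inside \<open>S\<close>, where the colouring controls them.\<close>

definition strong :: "('a \<Rightarrow> 'a \<Rightarrow> bool) \<Rightarrow> 'a set \<Rightarrow> bool" where
  "strong E S \<longleftrightarrow> (\<forall>x\<in>S. \<forall>y\<in>S. (x, y) \<in> {(a, b). a \<in> S \<and> b \<in> S \<and> E a b}\<^sup>*)"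

lemma strong_reverse:
  assumes "strong E S"
  shows "strong (\<lambda>a b. E b a) S"
proof -
  have eq: "{(a, b). a \<in> S \<and> b \<in> S \<and> E b a} = {(a, b). a \<in> S \<and> b \<in> S \<and> E a b}\<inverse>"
    by auto
  show ?thesis
    using assms unfolding strong_def eq by (simp add: rtrancl_converse)
qed

lemma strong_crossing:
  assumes "strong E S" "x \<in> S" "y \<in> S" "P x" "\<not> P y"
  obtains a b where "a \<in> S" "b \<in> S" "E a b" "P a" "\<not> P b"
proof -
  have "(x, y) \<in> {(a, b). a \<in> S \<and> b \<in> S \<and> E a b}\<^sup>*"
    using assms by (simp add: strong_def)
  then have "\<not> P y \<longrightarrow> (\<exists>a\<in>S. \<exists>b\<in>S. E a b \<and> P a \<and> \<not> P b)"
    by (induction rule: rtrancl_induct) (use \<open>P x\<close> in auto)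
  then show ?thesis
    using assms(5) that by blast
qed

lemma strong_insert:
  assumes S: "strong E S" and "d \<in> S" "i \<in> S" "E v d" "E i v"
  shows "strong E (insert v S)"
  unfolding strong_def
proof (intro ballI)
  let ?r = "{(a, b). a \<in> S \<and> b \<in> S \<and> E a b}"
  let ?r' = "{(a, b). a \<in> insert v S \<and> b \<in> insert v S \<and> E a b}"
  have mono: "(a, b) \<in> ?r'\<^sup>*" if "a \<in> S" "b \<in> S" for a b
  proof -
    have "?r \<subseteq> ?r'" by auto
    then show ?thesis
      using S that rtrancl_mono unfolding strong_def by blast
  qed
  have vd: "(v, d) \<in> ?r'" and iv: "(i, v) \<in> ?r'"
    using assms by auto
  have from_v: "(v, b) \<in> ?r'\<^sup>*" if "b \<in> S" for b
    using vd mono[OF \<open>d \<in> S\<close> that] by (rule converse_rtrancl_into_rtrancl)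
  have to_v: "(a, v) \<in> ?r'\<^sup>*" if "a \<in> S" for a
    using mono[OF that \<open>i \<in> S\<close>] iv by (rule rtrancl_into_rtrancl)
  fix x y assume "x \<in> insert v S" "y \<in> insert v S"
  then show "(x, y) \<in> ?r'\<^sup>*"
    using mono from_v to_v by blast
qed

lemma strong_triangle:
  assumes "E a b" "E b c" "E c a"
  shows "strong E {a, b, c}"
proof -
  let ?r = "{(x, y). x \<in> {a, b, c} \<and> y \<in> {a, b, c} \<and> E x y}"
  have "(a, b) \<in> ?r" "(b, c) \<in> ?r" "(c, a) \<in> ?r"
    using assms by auto
  then have "(a, b) \<in> ?r\<^sup>*" "(b, c) \<in> ?r\<^sup>*" "(c, a) \<in> ?r\<^sup>*"
    "(a, c) \<in> ?r\<^sup>*" "(b, a) \<in> ?r\<^sup>*" "(c, b) \<in> ?r\<^sup>*"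
    by (meson r_into_rtrancl rtrancl_trans)+
  then show ?thesis
    unfolding strong_def by blast
qed

text \<open>The combinatorics needs adjacency only. With a plain relation, reversing all arcs is a
  swap of arguments; \<open>asym\<close> also excludes loops.\<close>

locale tournament_relation =
  fixes V :: "'a set" and E :: "'a \<Rightarrow> 'a \<Rightarrow> bool"
  assumes finite_V: "finite V"
    and E_in_V: "E a b \<Longrightarrow> a \<in> V \<and> b \<in> V"
    and asym: "E a b \<Longrightarrow> \<not> E b a"
    and total: "a \<in> V \<Longrightarrow> b \<in> V \<Longrightarrow> a \<noteq> b \<Longrightarrow> E a b \<or> E b a"
begin

text \<open>On a shortest walk inside \<open>S\<close>, a repeated vertex or a forward chord would
  give a shortcut, so every chord points back. In particular, three consecutive vertices form a
  cyclic triangle.\<close>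

lemma strong_induced_path:
  assumes "strong E S" "S \<subseteq> V" "x \<in> S" "y \<in> S"
  obtains p :: "nat \<Rightarrow> 'a" and k where "p 0 = x" "p k = y" "\<And>j. j \<le> k \<Longrightarrow> p j \<in> S"
    "\<And>j. j < k \<Longrightarrow> E (p j) (p (Suc j))"
    "\<And>i j. Suc (Suc i) \<le> j \<Longrightarrow> j \<le> k \<Longrightarrow> E (p j) (p i)"
proof -
  let ?r = "{(a, b). a \<in> S \<and> b \<in> S \<and> E a b}"
  define k where "k = (LEAST n. (x, y) \<in> ?r ^^ n)"
  have "\<exists>n. (x, y) \<in> ?r ^^ n"
    using assms by (simp add: strong_def rtrancl_power)
  then have "(x, y) \<in> ?r ^^ k"
    unfolding k_def by (rule LeastI_ex)
  then obtain p where p: "p 0 = x" "p k = y" "\<And>j. j < k \<Longrightarrow> (p j, p (Suc j)) \<in> ?r"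
    by (auto simp: relpow_fun_conv)
  have least: "k \<le> n" if "(x, y) \<in> ?r ^^ n" for n
    unfolding k_def using that by (rule Least_le)
  have seg: "(p i, p (i + n)) \<in> ?r ^^ n" if "i + n \<le> k" for i n
    unfolding relpow_fun_conv
    by (rule exI[of _ "\<lambda>j. p (i + j)"]) (use p(3) that in auto)
  have inS: "p j \<in> S" if "j \<le> k" for j
  proof (cases "j = k")
    case False
    then show ?thesis using p(3)[of j] that by auto
  qed (use p assms in auto)
  have chord: "E (p j) (p i)" if "Suc (Suc i) \<le> j" "j \<le> k" for i j
  proof -
    have from_x: "(x, p i) \<in> ?r ^^ i" and to_y: "(p j, y) \<in> ?r ^^ (k - j)"
      using seg[of 0 i] seg[of j "k - j"] p that by auto
    have "p i \<noteq> p j"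
    proof
      assume "p i = p j"
      then have "(x, y) \<in> ?r ^^ (i + (k - j))"
        using from_x to_y relpow_add[of i "k - j" ?r] by auto
      from least[OF this] show False using that by auto
    qed
    moreover have "\<not> E (p i) (p j)"
    proof
      assume "E (p i) (p j)"
      then have "(p i, p j) \<in> ?r"
        using inS that by auto
      then have "(x, p j) \<in> ?r ^^ Suc i"
        using from_x by auto
      then have "(x, y) \<in> ?r ^^ (Suc i + (k - j))"
        using to_y relpow_add[of "Suc i" "k - j" ?r] by blast
      from least[OF this] show False using that by auto
    qed
    ultimately show ?thesis
      using total[of "p i" "p j"] inS[of i] inS[of j] that assms(2) by auto
  qed
  show ?thesis
    using that[of p k] p inS chord by auto
qed

text \<open>Meant for the out-neighbours of \<open>v\<close> in one colour class, on which a rainbow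
  colouring makes \<open>E\<close> transitive.\<close>

lemma first_element:
  assumes "finite W" "W \<noteq> {}" "W \<subseteq> V"
    and trans: "\<And>a b c. a \<in> W \<Longrightarrow> b \<in> W \<Longrightarrow> c \<in> W \<Longrightarrow> E a b \<Longrightarrow> E b c \<Longrightarrow> E a c"
  obtains m where "m \<in> W" "\<And>w. w \<in> W \<Longrightarrow> w \<noteq> m \<Longrightarrow> E m w"
proof -
  have "\<exists>m\<in>W. \<forall>w\<in>W. w \<noteq> m \<longrightarrow> E m w"
    using assms
  proof (induction W rule: finite_ne_induct)
    case (insert x F)
    then obtain m where m: "m \<in> F" "\<forall>w\<in>F. w \<noteq> m \<longrightarrow> E m w"
      using insert.prems by (metis insert_iff insert_subset)
    have tr: "E a c" if "E a b" "E b c" "a \<in> insert x F" "b \<in> insert x F" "c \<in> insert x F" for a b c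
      using insert.prems(2)[of a b c] that by simp
    have "x \<noteq> m" using m insert.hyps by blast
    then consider "E x m" | "E m x"
      using total[of x m] m insert.prems(1) by blast
    then show ?case
    proof cases
      case 1
      have "E x w" if "w \<in> F" for w
        using that m tr[OF 1, of w] 1 by (cases "w = m") simp_all
      then have "\<forall>w\<in>insert x F. w \<noteq> x \<longrightarrow> E x w"
        by blast
      then show ?thesis by blast
    next
      case 2
      then show ?thesis using m by blast
    qed
  qed auto
  then show ?thesis using that by blast
qed

end

text \<open>The cyclic triangles \<open>p q s\<close> and \<open>p r s\<close> share
  \<open>p\<close> and \<open>s\<close>, which forces one colour on \<open>q\<close> and
  \<open>r\<close>; but these lie together in the cyclic triangle \<open>q r t\<close>. No triangle
  used contains both \<open>s\<close> and \<open>t\<close>, so \<open>T5\<close> and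
  \<open>U5\<close> are excluded at once.\<close>

lemma (in tournament_relation) rainbow_imp_no_near_T5:
  assumes "rainbow E V col"
  shows "\<not> near_T5 E p q r s t"
proof
  assume "near_T5 E p q r s t"
  then have e: "E p q" "E q s" "E s p" "E p r" "E r s" "E r t" "E t p" "E q r" "E t q"
    by (auto simp: near_T5_def)
  have V: "p \<in> V" "q \<in> V" "r \<in> V" "s \<in> V" "t \<in> V"
    using e E_in_V by blast+
  have tri: "distinct [col a, col b, col c]" if "E a b" "E b c" "E c a" "a \<in> V" "b \<in> V" "c \<in> V" for a b c
    using assms that unfolding rainbow_def by blast
  have lt: "col p < 3" "col q < 3" "col r < 3" "col s < 3"
    using assms V unfolding rainbow_def by blast+
  have "distinct [col p, col q, col s]" "distinct [col p, col r, col s]" "distinct [col q, col r, col t]"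
    using tri[of p q s] tri[of p r s] tri[of q r t] e V by blast+
  then show False
    using lt by simp
qed

section \<open>Extending a colouring by one vertex\<close>

text \<open>One step in the enlargement of a coloured strong set \<open>S\<close>. Primeness is
  represented by the absence of two configurations, a condition that survives the reversal of all
  arcs.\<close>

locale vertex_extension = tournament_relation +
  fixes S :: "'a set" and col :: "'a \<Rightarrow> nat" and v :: 'a
  assumes no_near_T5: "\<not> near_T5 E p q r s t"
    and no_blown_triangle: "\<not> blown_triangle E a b c d e"
    and S_V: "S \<subseteq> V" and v_V: "v \<in> V" and v_S: "v \<notin> S"
    and strong_S: "strong E S" and rainbow_S: "rainbow E S col"
begin

text \<open>Both configurations are self-dual: \<open>near_T5\<close> by exchanging \<open>p\<close>
  with \<open>r\<close> and \<open>s\<close> with \<open>t\<close>, \<open>blown_triangle\<close> by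
  exchanging \<open>a\<close> with \<open>c\<close> and \<open>d\<close> with
  \<open>e\<close>.\<close>

lemma rev_extension: "vertex_extension V (\<lambda>a b. E b a) S col v"
proof
  show "\<not> near_T5 (\<lambda>a b. E b a) p q r s t" for p q r s t
    using no_near_T5[of r q p t s] by (auto simp: near_T5_def)
  show "\<not> blown_triangle (\<lambda>a b. E b a) a b c d e" for a b c d e
    using no_blown_triangle[of c b a e d] by (auto simp: blown_triangle_def)
  show "rainbow (\<lambda>a b. E b a) S col"
    using rainbow_S unfolding rainbow_def by auto
qed (use finite_V E_in_V asym total S_V v_V v_S strong_reverse[OF strong_S] in auto)

lemma near_T5D:
  assumes "E p q" "E q r" "E p r" "E s p" "E q s" "E r s" "E t p" "E t q" "E r t"
  shows False
  using no_near_T5 assms unfolding near_T5_def by blast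

section \<open>Arcs and colours inside \<open>S\<close>\<close>

text \<open>A cyclic triangle needs three colours, so the arc between \<open>a\<close> and
  \<open>c\<close> cannot point back. Most arcs below are derived in this way.\<close>

lemma two_colour_trans:
  assumes "E a b" "E b c" "a \<in> S" "b \<in> S" "c \<in> S" "col a = col b \<or> col b = col c \<or> col a = col c"
  shows "E a c"
proof -
  have "\<not> E c a"
    using rainbow_S assms unfolding rainbow_def by fastforce
  then show ?thesis
    using total[of a c] asym assms S_V by blast
qed

lemma triangle_colours:
  assumes "E a b" "E b c" "E c a" "a \<in> S" "b \<in> S" "c \<in> S"
  shows "col a \<noteq> col b" "col b \<noteq> col c" "col a \<noteq> col c"
  using rainbow_S assms unfolding rainbow_def by fastforce+

lemma col_less: "a \<in> S \<Longrightarrow> col a < 3"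
  using rainbow_S by (simp add: rainbow_def)

lemma third_colour:
  assumes "a \<in> S" "b \<in> S" "c \<in> S" "d \<in> S" "col a \<noteq> col b" "col b \<noteq> col c" "col a \<noteq> col c"
    "col d \<noteq> col a" "col d \<noteq> col b"
  shows "col d = col c"
  using assms(5-) col_less[OF assms(1)] col_less[OF assms(2)] col_less[OF assms(3)] col_less[OF assms(4)]
  by linarith

lemma in_or_out: "a \<in> S \<Longrightarrow> E v a \<or> E a v"
  using total[of v a] S_V v_V v_S by blast

text \<open>Consecutive triples of a shortest path are cyclic triangles, so the colours along the path have
  period 3, and some stretch of length 3 leads from \<open>P\<close> to its complement.\<close>

lemma same_colour_path:
  assumes xy: "x \<in> S" "y \<in> S" "col x = col y" "E y x" "P x" "\<not> P y"
  obtains q0 q1 q2 q3 where "q0 \<in> S" "q1 \<in> S" "q2 \<in> S" "q3 \<in> S"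
    "E q0 q1" "E q1 q2" "E q2 q3" "E q2 q0" "E q3 q0" "E q3 q1"
    "P q0" "\<not> P q3" "col q0 = col x" "col q3 = col x"
    "col q1 \<noteq> col x" "col q2 \<noteq> col x" "col q1 \<noteq> col q2"
proof -
  obtain p k where p: "p 0 = x" "p k = y" and inS: "\<And>j. j \<le> k \<Longrightarrow> p j \<in> S"
    and step: "\<And>j. j < k \<Longrightarrow> E (p j) (p (Suc j))"
    and chord: "\<And>i j. Suc (Suc i) \<le> j \<Longrightarrow> j \<le> k \<Longrightarrow> E (p j) (p i)"
    using strong_induced_path[OF strong_S S_V xy(1,2)] by metis
  have "\<not> E x y" "x \<noteq> y"
    using asym[OF xy(4)] xy(4) by auto
  then have "k \<noteq> 0" "k \<noteq> 1"
    using p step[of 0] by (metis One_nat_def zero_less_one)+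
  then have k: "k \<ge> 2" by simp
  have tri: "col (p i) \<noteq> col (p (Suc i))" "col (p (Suc i)) \<noteq> col (p (Suc (Suc i)))"
    "col (p i) \<noteq> col (p (Suc (Suc i)))" if "Suc (Suc i) \<le> k" for i
    using triangle_colours[of "p i" "p (Suc i)" "p (Suc (Suc i))"] step[of i] step[of "Suc i"]
      chord[of i "Suc (Suc i)"] inS that by auto
  have period: "col (p (j + 3)) = col (p j)" if "j + 3 \<le> k" for j
  proof -
    have le: "Suc (Suc j) \<le> k" "Suc (Suc (Suc j)) \<le> k" using that by auto
    have "col (p (Suc (Suc (Suc j)))) = col (p j)"
      by (rule third_colour[OF _ _ _ _ tri(2)[OF le(1)] tri(3)[OF le(1), symmetric]
            tri(1)[OF le(1), symmetric] tri(3)[OF le(2), symmetric] tri(2)[OF le(2), symmetric]])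
        (use inS le in simp_all)
    then show ?thesis by (simp add: numeral_3_eq_3)
  qed
  have colmod: "col (p j) = col (p (j mod 3))" if "j \<le> k" for j
    using that
  proof (induction j rule: less_induct)
    case (less j)
    show ?case
    proof (cases "j < 3")
      case False
      then have "col (p (j - 3)) = col (p ((j - 3) mod 3))" "col (p j) = col (p (j - 3))"
        using less.IH[of "j - 3"] less.prems period[of "j - 3"] by simp_all
      moreover have "(j - 3) mod 3 = j mod 3"
        using False by (simp add: le_mod_geq)
      ultimately show ?thesis by simp
    qed simp
  qed
  \<comment> \<open>The ends of the path share a colour, which positions 1 and 2 do not
    have.\<close>
  have "k mod 3 = 0"
  proof -
    have "col (p (k mod 3)) = col (p 0)"
      using colmod[of k] p xy by simp
    moreover have "col (p 0) \<noteq> col (p 1)" "col (p 0) \<noteq> col (p 2)"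
      using tri(1)[of 0] tri(3)[of 0] k by (simp_all add: numeral_2_eq_2)
    moreover have "k mod 3 = 0 \<or> k mod 3 = 1 \<or> k mod 3 = 2"
      by presburger
    ultimately show ?thesis by metis
  qed
  then obtain n where n: "k = 3 * n" by auto
  \<comment> \<open>\<open>3 * m\<close> is the first position divisible by 3 where \<open>P\<close>
    fails, so \<open>P\<close> still holds three positions earlier.\<close>
  define m where "m = (LEAST i. \<not> P (p (3 * i)))"
  have notP: "\<not> P (p (3 * m))"
    unfolding m_def by (rule LeastI[of _ n]) (use n p xy in simp)
  have "m \<le> n"
    unfolding m_def by (rule Least_le) (use n p xy in simp)
  have "m \<noteq> 0"
  proof
    assume "m = 0"
    then show False using notP p xy by simp
  qed
  then obtain l where l: "m = Suc l" by (cases m) auto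
  have Pl: "P (p (3 * l))"
    using not_less_Least[of l "\<lambda>i. \<not> P (p (3 * i))"] l by (simp add: m_def)
  define j where "j = 3 * l"
  have jk: "j + 3 \<le> k" using \<open>m \<le> n\<close> l n by (simp add: j_def)
  have c: "col (p j) = col x" "col (p (j + 3)) = col x"
    using colmod[of j] period[OF jk] jk p by (simp_all add: j_def)
  show ?thesis
  proof (rule that[of "p j" "p (Suc j)" "p (Suc (Suc j))" "p (j + 3)"])
    show "\<not> P (p (j + 3))" using notP l by (simp add: j_def add.commute)
    show "P (p j)" using Pl by (simp add: j_def)
    have e: "j + 3 = Suc (Suc (Suc j))" by simp
    show "E (p (Suc (Suc j))) (p (j + 3))"
      unfolding e by (rule step) (use jk in simp)
    show "E (p (j + 3)) (p j)" "E (p (j + 3)) (p (Suc j))" "E (p (Suc (Suc j))) (p j)"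
      by (rule chord; use jk in simp)+
    show "col (p (Suc j)) \<noteq> col x" "col (p (Suc (Suc j))) \<noteq> col x"
      "col (p (Suc j)) \<noteq> col (p (Suc (Suc j)))"
      using tri[of j] c jk by simp_all
  qed (use inS step c jk in simp_all)
qed

section \<open>Back arcs at \<open>v\<close> and their colours\<close>

text \<open>A path from \<open>i\<close> to \<open>d\<close> contains a stretch
  \<open>q0 q1 q2 q3\<close> whose ends have the colour of \<open>i\<close>, with \<open>q0\<close>
  an in-neighbour and \<open>q3\<close> an out-neighbour of \<open>v\<close>. The arcs between
  \<open>v\<close> and the inner vertices decide which configuration appears: \<open>near_T5\<close>
  twice, \<open>blown_triangle\<close> in the last case.\<close>

lemma no_monochromatic_back_edge:
  assumes "d \<in> S" "i \<in> S" "E v d" "E i v" "E d i"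
  shows "col d \<noteq> col i"
proof
  assume "col d = col i"
  then obtain q0 q1 q2 q3 where q: "q0 \<in> S" "q1 \<in> S" "q2 \<in> S" "q3 \<in> S"
    "E q0 q1" "E q1 q2" "E q2 q3" "E q2 q0" "E q3 q0" "E q3 q1" "\<not> E v q0" "E v q3"
    using same_colour_path[of i d "\<lambda>u. \<not> E v u"] assms asym by metis
  have "E q0 v" using q in_or_out by blast
  consider "E q1 v" | "E v q1" "E v q2" | "E v q1" "E q2 v"
    using q in_or_out by blast
  then show False
  proof cases
    case 1
    then show False
      using near_T5D[of q3 q0 q1 v q2] q \<open>E q0 v\<close> by blast
  next
    case 2
    then show False
      using near_T5D[of q2 q3 q0 q1 v] q \<open>E q0 v\<close> by blast
  next
    case 3
    then show False
      using no_blown_triangle[of q3 q0 v q1 q2] q \<open>E q0 v\<close> by (auto simp: blown_triangle_def)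
  qed
qed

lemma in_before_out:
  assumes "i \<in> S" "d \<in> S" "E i v" "E v d" "col i = col d"
  shows "E i d"
proof -
  have "i \<noteq> d" using asym[OF assms(3)] assms(4) by auto
  moreover have "\<not> E d i" using no_monochromatic_back_edge[OF assms(2,1,4,3)] assms(5) by auto
  moreover have "i \<in> V" "d \<in> V" using assms S_V by auto
  ultimately show ?thesis using total by blast
qed

text \<open>The cyclic triangles through \<open>v\<close> are its back arcs, from an out-neighbour of \<open>v\<close> to an
  in-neighbour. The colouring extends to \<open>v\<close> iff all of them have the same pair of distinct colours.\<close>

definition back_pair :: "nat \<Rightarrow> nat \<Rightarrow> bool" where
  "back_pair P Q \<longleftrightarrow> (\<exists>d\<in>S. \<exists>i\<in>S. E v d \<and> E i v \<and> E d i \<and> col d = P \<and> col i = Q)"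

text \<open>Given back arcs \<open>d -> i\<close> and \<open>d' -> i'\<close> with swapped colours,
  \<open>in_before_out\<close> gives \<open>i -> d'\<close> and \<open>i' -> d\<close>. Following
  \<open>d -> i -> d' -> i'\<close> by \<open>two_colour_trans\<close> gives \<open>d -> i'\<close>,
  a contradiction.\<close>

lemma back_asym:
  assumes "back_pair P Q"
  shows "\<not> back_pair Q P"
proof
  assume "back_pair Q P"
  with assms obtain d i d' i' where *: "d \<in> S" "i \<in> S" "E v d" "E i v" "E d i" "col d = P" "col i = Q"
    "d' \<in> S" "i' \<in> S" "E v d'" "E i' v" "E d' i'" "col d' = Q" "col i' = P"
    unfolding back_pair_def by blast
  have "E i d'" "E i' d" using in_before_out * by auto
  then have "E d d'" using two_colour_trans[of d i d'] * by simp
  then have "E d i'" using two_colour_trans[of d d' i'] * by simp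
  then show False using \<open>E i' d\<close> asym by blast
qed

text \<open>Since \<open>y\<close> precedes \<open>y'\<close> in their colour class, also
  \<open>x -> y'\<close> and \<open>y -> z\<close>. An arc from \<open>z\<close> to \<open>x\<close>
  would then complete a \<open>near_T5\<close>.\<close>

lemma back_chain_edge:
  assumes "x \<in> S" "y \<in> S" "y' \<in> S" "z \<in> S" "E v x" "E x y" "E y v" "E v y'" "E y' z" "E z v"
    "col y = col y'"
  shows "\<not> E z x"
proof
  assume zx: "E z x"
  have "E y y'" using in_before_out assms by blast
  moreover have "E x y'" using two_colour_trans[of x y y'] \<open>E y y'\<close> assms by simp
  moreover have "E y z" using two_colour_trans[of y y' z] \<open>E y y'\<close> assms by simp
  ultimately show False
    using near_T5D[of z v x y' y] zx assms by blast
qed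

text \<open>A chain of two pairs uses all three colours. A path from \<open>b0'\<close> back to
  \<open>b0\<close> supplies a stretch with ends coloured \<open>Q\<close> and inner vertices
  coloured \<open>P\<close> and \<open>R\<close>. In the order \<open>P\<close>, \<open>R\<close> it
  yields a \<open>near_T5\<close>, in the order \<open>R\<close>, \<open>P\<close> an arc that
  \<open>back_chain_edge\<close> forbids.\<close>

lemma back_no_chain:
  assumes "back_pair P Q" "P \<noteq> R"
  shows "\<not> back_pair Q R"
proof
  assume "back_pair Q R"
  with assms obtain a b0 b0' c where abc: "a \<in> S" "b0 \<in> S" "b0' \<in> S" "c \<in> S"
    "E v a" "E b0 v" "E a b0" "col a = P" "col b0 = Q"
    "E v b0'" "E c v" "E b0' c" "col b0' = Q" "col c = R"
    unfolding back_pair_def by blast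
  have PQR: "P \<noteq> Q" "Q \<noteq> R" "P \<noteq> R"
    using no_monochromatic_back_edge[of a b0] no_monochromatic_back_edge[of b0' c] abc assms by auto
  have "E b0 b0'" using in_before_out abc by auto
  then obtain q0 q1 q2 q3 where q: "q0 \<in> S" "q1 \<in> S" "q2 \<in> S" "q3 \<in> S"
    "E q0 q1" "E q1 q2" "E q2 q3" "E q2 q0" "E q3 q0" "E q3 q1" "E v q0" "\<not> E v q3"
    "col q0 = Q" "col q3 = Q" "col q1 \<noteq> Q" "col q2 \<noteq> Q" "col q1 \<noteq> col q2"
    using same_colour_path[of b0' b0 "\<lambda>u. E v u"] abc asym by metis
  have q3v: "E q3 v" using q in_or_out by blast
  \<comment> \<open>\<open>b\<close> is the later of \<open>b0\<close> and \<open>q3\<close> in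
    their colour class, so it receives arcs from both \<open>a\<close> and
    \<open>q2\<close>.\<close>
  obtain b where b: "b \<in> S" "E b v" "E a b" "col b = Q" "b = q3 \<or> E q3 b"
  proof (cases "b0 = q3 \<or> E q3 b0")
    case True
    then show ?thesis using that[of b0] abc by auto
  next
    case False
    then have "E b0 q3" using total[of b0 q3] abc q S_V by blast
    then have "E a q3" using two_colour_trans[of a b0 q3] abc q by simp
    then show ?thesis using that[of q3] q q3v by auto
  qed
  \<comment> \<open>Dually, \<open>b'\<close> is the earlier of \<open>b0'\<close> and
    \<open>q0\<close>, with arcs to both \<open>c\<close> and \<open>q1\<close>.\<close>
  obtain b' where b': "b' \<in> S" "E v b'" "E b' c" "col b' = Q" "b' = q0 \<or> E b' q0"
  proof (cases "b0' = q0 \<or> E b0' q0")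
    case True
    then show ?thesis using that[of b0'] abc by auto
  next
    case False
    then have "E q0 b0'" using total[of b0' q0] abc q S_V by blast
    then have "E q0 c" using two_colour_trans[of q0 b0' c] abc q by simp
    then show ?thesis using that[of q0] q by auto
  qed
  have bb': "E b b'" using in_before_out b b' by auto
  have q2b: "E q2 b" using two_colour_trans[of q2 q3 b] b q by auto
  have b'q1: "E b' q1" using two_colour_trans[of b' q0 q1] b' q by auto
  have colours: "col q1 = P \<and> col q2 = R \<or> col q1 = R \<and> col q2 = P"
    using third_colour[of a b c q1] third_colour[of b c a q1] third_colour[of a b c q2]
      third_colour[of b c a q2] abc b q PQR by metis
  then show False
  proof
    assume c12: "col q1 = P \<and> col q2 = R"
    have bq1: "E b q1" using two_colour_trans[of b b' q1] b b' bb' b'q1 q by simp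
    have aq1: "E a q1" using two_colour_trans[of a b q1] abc b bq1 q c12 by simp
    have vq1: "E v q1"
      using no_monochromatic_back_edge[of a q1] in_or_out[of q1] abc aq1 c12 q by auto
    have "E q2 b'" using two_colour_trans[of q2 b b'] b b' bb' q2b q by simp
    then have "E q2 c" using two_colour_trans[of q2 b' c] abc b' q c12 by simp
    then have q2v: "E q2 v"
      using no_monochromatic_back_edge[of q2 c] in_or_out[of q2] abc c12 q by auto
    have "E a q2" using two_colour_trans[of a q1 q2] abc aq1 q c12 by simp
    then show False
      using near_T5D[of q2 b v q1 a] q2b b q2v q bq1 vq1 abc by blast
  next
    assume c12: "col q1 = R \<and> col q2 = P"
    \<comment> \<open>Triangles \<open>v y' z\<close> and \<open>v x y\<close> are chosen with
      \<open>z\<close> at or before \<open>q1\<close> and \<open>x\<close> at or after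
      \<open>q2\<close>, so that the arc from \<open>q1\<close> to \<open>q2\<close> forces one from
      \<open>z\<close> to \<open>x\<close>.\<close>
    obtain z y' where z: "z \<in> S" "y' \<in> S" "E z v" "E v y'" "E y' z" "col z = R" "col y' = Q"
      "z = q1 \<or> E z q1"
    proof (cases "E q1 v")
      case True
      then show ?thesis using that[of q1 q0] q c12 by auto
    next
      case False
      then have "E c q1" using in_before_out[of c q1] in_or_out[of q1] abc q c12 by auto
      then show ?thesis using that[of c b0'] abc by auto
    qed
    obtain x y where x: "x \<in> S" "y \<in> S" "E v x" "E y v" "E x y" "col x = P" "col y = Q"
      "x = q2 \<or> E q2 x"
    proof (cases "E v q2")
      case True
      then show ?thesis using that[of q2 q3] q c12 q3v by auto
    next
      case False
      then have "E q2 a" using in_before_out[of q2 a] in_or_out[of q2] abc q c12 by auto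
      then show ?thesis using that[of a b0] abc by auto
    qed
    have "E z q2" using two_colour_trans[of z q1 q2] z q c12 by auto
    then have "E z x" using two_colour_trans[of z q2 x] z x q c12 by auto
    then show False
      using back_chain_edge[of x y y' z] z x by simp
  qed
qed

text \<open>Only the first few vertices of a shortest path from \<open>e\<close> to \<open>a\<close> matter: whatever their colours, they
  give a forbidden configuration or a chain of two back pairs.\<close>

lemma back_no_cospan_aux:
  assumes a: "a \<in> S" "E v a" "E a b" and e: "e \<in> S" "E v e" "E e b" and b: "b \<in> S" "E b v"
    and first: "\<And>w. w \<in> S \<Longrightarrow> E v w \<Longrightarrow> col w = col e \<Longrightarrow> w \<noteq> e \<Longrightarrow> E e w"
    and "E a e" and ne: "col a \<noteq> col e"
  shows False
proof -
  have c: "col a \<noteq> col b" "col e \<noteq> col b"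
    using no_monochromatic_back_edge[of a b] no_monochromatic_back_edge[of e b] a e b by auto
  have bk: "back_pair (col a) (col b)" "back_pair (col e) (col b)"
    using a e b unfolding back_pair_def by blast+
  obtain p k where p: "p 0 = e" "p k = a" and inS: "\<And>j. j \<le> k \<Longrightarrow> p j \<in> S"
    and step: "\<And>j. j < k \<Longrightarrow> E (p j) (p (Suc j))"
    and chord: "\<And>i j. Suc (Suc i) \<le> j \<Longrightarrow> j \<le> k \<Longrightarrow> E (p j) (p i)"
    using strong_induced_path[OF strong_S S_V e(1) a(1)] by metis
  define p1 p2 p3 where "p1 = p 1" and "p2 = p 2" and "p3 = p 3"
  have "\<not> E e a" "e \<noteq> a"
    using asym[OF \<open>E a e\<close>] ne by auto
  then have "k \<noteq> 0" "k \<noteq> 1"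
    using p step[of 0] by (metis One_nat_def zero_less_one)+
  then have k: "k \<ge> 2" by simp
  have p12: "p1 \<in> S" "p2 \<in> S" "E e p1" "E p1 p2" "E p2 e"
    using k inS step[of 0] step[of 1] chord[of 0 2] p
    by (auto simp: p1_def p2_def numeral_2_eq_2)
  note c12 = triangle_colours[OF p12(3-5) e(1) p12(1,2)]
  \<comment> \<open>If the path continues past \<open>p2\<close>, then \<open>p3\<close> repeats the
    colour of \<open>e\<close>. It dominates \<open>e\<close>, the first out-neighbour of
    \<open>v\<close> in that colour, so it is an in-neighbour. As \<open>a\<close> has another
    colour, the path cannot end at \<open>p3\<close>.\<close>
  have p3: "p3 \<in> S" "E p2 p3" "E p3 p1" "E p3 v" "col p3 = col e" "k \<ge> 4" if "p2 \<noteq> a"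
  proof -
    have "k \<noteq> 2" using that p by (auto simp: p2_def)
    then have k3: "k \<ge> 3" using k by simp
    show *: "p3 \<in> S" "E p2 p3" "E p3 p1"
      using k3 inS step[of 2] chord[of 1 3] by (auto simp: p1_def p2_def p3_def numeral_3_eq_3 numeral_2_eq_2)
    show c3: "col p3 = col e"
      using third_colour[of p1 p2 e p3] triangle_colours[of p1 p2 p3] * c12 p12 e by auto
    then have "k \<noteq> 3" using p ne by (auto simp: p3_def)
    then show "k \<ge> 4" using k3 by simp
    have "E p3 e" using k3 chord[of 0 3] p by (simp add: p3_def)
    then have "p3 \<noteq> e" "\<not> E e p3" using asym by blast+
    then show "E p3 v"
      using first[of p3] in_or_out * c3 by blast
  qed
  have "col p1 = col a \<and> col p2 = col b \<or> col p1 = col b \<and> col p2 = col a"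
    using third_colour[of e a b p1] third_colour[of e b a p1] third_colour[of e a b p2]
      third_colour[of e b a p2] c12 p12 a b e c ne by metis
  then show False
  proof
    assume cc: "col p1 = col a \<and> col p2 = col b"
    then have "p2 \<noteq> a" using c by auto
    note p3 = p3[OF this]
    have "E a p1" using chord[of 1 k] p \<open>k \<ge> 4\<close> by (simp add: p1_def)
    then have vp1: "E v p1"
      using no_monochromatic_back_edge[of a p1] in_or_out[of p1] a p12 cc by auto
    \<comment> \<open>Otherwise \<open>p2 -> p3\<close> is a back arc whose pair continues that of
      \<open>a -> b\<close>.\<close>
    have "\<not> E v p2"
    proof
      assume "E v p2"
      then have "back_pair (col b) (col e)"
        unfolding back_pair_def using p12 p3 cc by blast
      then show False using back_no_chain[OF bk(1)] ne by blast
    qed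
    then have p2v: "E p2 v" using in_or_out p12 by blast
    have p2b: "E p2 b" using two_colour_trans[of p2 e b] p12 b e cc by simp
    have "E p1 b" using two_colour_trans[of p1 p2 b] p12 b cc p2b by simp
    then show False
      using near_T5D[of v e p1 b p2] e p12 vp1 b p2v by blast
  next
    assume cc: "col p1 = col b \<and> col p2 = col a"
    show False
    proof (cases "p2 = a")
      case True
      have "E p1 b" using two_colour_trans[of p1 a b] p12 True a b cc by simp
      then have "E p1 v"
        using no_monochromatic_back_edge[of p1 b] in_or_out[of p1] b p12 cc by auto
      then show False
        using near_T5D[of v a e b p1] a e b p12 True \<open>E a e\<close> by blast
    next
      case False
      note p3 = p3[OF this]
      have "E a p2" using chord[of 2 k] p \<open>k \<ge> 4\<close> by (simp add: p2_def)
      then have "E v p2"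
        using no_monochromatic_back_edge[of a p2] in_or_out[of p2] a p12 cc by auto
      \<comment> \<open>The back arc \<open>p2 -> p3\<close> has a pair that is continued by that of
        \<open>e -> b\<close>.\<close>
      then have "back_pair (col a) (col e)"
        unfolding back_pair_def using p12 p3 cc by metis
      then show False using back_no_chain[of "col a" "col e" "col b"] bk c by blast
    qed
  qed
qed

text \<open>Both back arcs can be made to end at one vertex \<open>b\<close>, the later of the two
  end vertices, and to start at the first out-neighbours of \<open>v\<close> in colours
  \<open>P\<close> and \<open>R\<close>. The auxiliary lemma then applies to either direction of the
  arc between the two starts.\<close>

lemma back_no_cospan:
  assumes "back_pair P Q" "back_pair R Q"
  shows "P = R"
proof (rule ccontr)
  assume "P \<noteq> R"
  obtain b where b: "b \<in> S" "E b v" "\<exists>a\<in>S. E v a \<and> E a b \<and> col a = P" "\<exists>e\<in>S. E v e \<and> E e b \<and> col e = R"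
  proof -
    obtain a b0 e b1 where *: "a \<in> S" "b0 \<in> S" "e \<in> S" "b1 \<in> S" "E v a" "E b0 v" "E a b0" "col a = P"
      "col b0 = Q" "E v e" "E b1 v" "E e b1" "col e = R" "col b1 = Q"
      using assms unfolding back_pair_def by blast
    consider "b0 = b1" | "E b0 b1" | "E b1 b0" using total[of b0 b1] * S_V by blast
    then show ?thesis
    proof cases
      case 1
      then show ?thesis using that[of b0] * by blast
    next
      case 2
      then have "E a b1" using two_colour_trans[of a b0 b1] * by simp
      then show ?thesis using that[of b1] * by blast
    next
      case 3
      then have "E e b0" using two_colour_trans[of e b1 b0] * by simp
      then show ?thesis using that[of b0] * by blast
    qed
  qed
  \<comment> \<open>Moving to the first out-neighbour of colour \<open>C\<close> keeps the arc to
    \<open>b\<close>, by \<open>two_colour_trans\<close>.\<close>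
  have first: "\<exists>m\<in>S. E v m \<and> E m b \<and> col m = C \<and> (\<forall>w\<in>S. E v w \<longrightarrow> col w = C \<longrightarrow> w \<noteq> m \<longrightarrow> E m w)"
    if ex: "\<exists>a\<in>S. E v a \<and> E a b \<and> col a = C" for C
  proof -
    obtain a where a: "a \<in> S" "E v a" "E a b" "col a = C" using ex by blast
    let ?W = "{w \<in> S. E v w \<and> col w = C}"
    have "?W \<subseteq> V" using S_V by blast
    moreover have "?W \<noteq> {}" using a by blast
    moreover have "E x z" if "x \<in> ?W" "y \<in> ?W" "z \<in> ?W" "E x y" "E y z" for x y z
      using two_colour_trans[of x y z] that by simp
    ultimately obtain m where m: "m \<in> ?W" "\<And>w. w \<in> ?W \<Longrightarrow> w \<noteq> m \<Longrightarrow> E m w"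
      using first_element[of ?W] finite_subset[OF _ finite_V] by blast
    have "E m b"
    proof (cases "a = m")
      case False
      then have "E m a" using m a by blast
      then show ?thesis using two_colour_trans[of m a b] a b m by simp
    qed (use a in simp)
    then show ?thesis using m by blast
  qed
  obtain a e where
    a: "a \<in> S" "E v a" "E a b" "col a = P" "\<forall>w\<in>S. E v w \<longrightarrow> col w = P \<longrightarrow> w \<noteq> a \<longrightarrow> E a w" and
    e: "e \<in> S" "E v e" "E e b" "col e = R" "\<forall>w\<in>S. E v w \<longrightarrow> col w = R \<longrightarrow> w \<noteq> e \<longrightarrow> E e w"
    using first[OF b(3)] first[OF b(4)] by blast
  have "a \<noteq> e" using a e \<open>P \<noteq> R\<close> by auto
  then consider "E a e" | "E e a" using total[of a e] a e S_V by blast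
  then show False
  proof cases
    case 1
    show False by (rule back_no_cospan_aux[of a b e]) (use a e b 1 \<open>P \<noteq> R\<close> in auto)
  next
    case 2
    show False by (rule back_no_cospan_aux[of e b a]) (use a e b 2 \<open>P \<noteq> R\<close> in auto)
  qed
qed

text \<open>Reversing all arcs swaps the in- and out-neighbours of \<open>v\<close>, and with them
  the two colours of a back pair.\<close>

lemma back_no_span:
  assumes "back_pair P Q" "back_pair P R"
  shows "Q = R"
proof -
  interpret rev: vertex_extension V "\<lambda>a b. E b a" S col v
    by (rule rev_extension)
  have "rev.back_pair Q P" "rev.back_pair R P"
    using assms unfolding rev.back_pair_def back_pair_def by blast+
  then show ?thesis
    by (rule rev.back_no_cospan)
qed

text \<open>Two pairs of distinct colours out of three share a colour. A common first or second
  colour forces equality; otherwise the pairs form a chain or are swapped, both impossible.\<close>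

lemma back_unique:
  assumes "back_pair P Q" "back_pair P' Q'"
  shows "P' = P \<and> Q' = Q"
proof -
  have lt: "C < 3 \<and> D < 3 \<and> C \<noteq> D" if "back_pair C D" for C D
  proof -
    from that obtain d i where "d \<in> S" "i \<in> S" "E v d" "E i v" "E d i" "col d = C" "col i = D"
      unfolding back_pair_def by blast
    then show ?thesis
      using no_monochromatic_back_edge[of d i] col_less[of d] col_less[of i] by simp
  qed
  consider "P' = P" | "P' = Q" | "Q' = P" | "Q' = Q"
    using lt[OF assms(1)] lt[OF assms(2)] by linarith
  then show ?thesis
  proof cases
    case 1
    then show ?thesis using back_no_span[of P Q Q'] assms by simp
  next
    case 2
    then show ?thesis using back_no_chain[of P Q Q'] back_asym[of P Q] assms by blast
  next
    case 3
    then show ?thesis using back_no_chain[of P' P Q] back_asym[of P Q] assms by blast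
  next
    case 4
    then show ?thesis using back_no_cospan[of P Q P'] assms by simp
  qed
qed

section \<open>Choice of a colour for \<open>v\<close>\<close>

text \<open>All back arcs carry the same two colours, so \<open>v\<close> takes the third; if there
  are none, \<open>v\<close> lies in no cyclic triangle with \<open>S\<close> and colour 0 will
  do.\<close>

lemma extend_rainbow:
  obtains c where "rainbow E (insert v S) (col(v := c))"
proof -
  obtain c :: nat where c: "c < 3" "\<And>P Q. back_pair P Q \<Longrightarrow> c \<noteq> P \<and> c \<noteq> Q"
  proof (cases "\<exists>P Q. back_pair P Q")
    case True
    then obtain P Q where PQ: "back_pair P Q" by blast
    define c :: nat where "c = (if P \<noteq> 0 \<and> Q \<noteq> 0 then 0 else if P \<noteq> 1 \<and> Q \<noteq> 1 then 1 else 2)"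
    have "c < 3" "c \<noteq> P" "c \<noteq> Q"
      by (auto simp: c_def)
    then show ?thesis
      using that[of c] back_unique[OF PQ] by metis
  qed (use that[of 0] in auto)
  have vtri: "distinct [c, col d, col i]" if "d \<in> S" "i \<in> S" "E v d" "E d i" "E i v" for d i
  proof -
    have "back_pair (col d) (col i)" using that unfolding back_pair_def by blast
    then show ?thesis using c(2)[of "col d" "col i"] no_monochromatic_back_edge[of d i] that by simp
  qed
  have irr: "\<not> E a a" for a using asym by blast
  have "rainbow E (insert v S) (col(v := c))"
    unfolding rainbow_def
  proof (intro conjI ballI impI)
    fix a b d assume *: "a \<in> insert v S" "b \<in> insert v S" "d \<in> insert v S" "E a b \<and> E b d \<and> E d a"
    consider "a \<in> S" "b \<in> S" "d \<in> S" | "a = v" | "b = v" | "d = v" using * by blast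
    then show "distinct [(col(v := c)) a, (col(v := c)) b, (col(v := c)) d]"
    proof cases
      case 1
      then show ?thesis using triangle_colours[of a b d] * v_S by auto
    next
      case 2
      then have "b \<noteq> v" "d \<noteq> v" using * irr by auto
      then show ?thesis using 2 * vtri[of b d] by auto
    next
      case 3
      then have "a \<noteq> v" "d \<noteq> v" using * irr by auto
      then show ?thesis using 3 * vtri[of d a] by auto
    next
      case 4
      then have "a \<noteq> v" "b \<noteq> v" using * irr by auto
      then show ?thesis using 4 * vtri[of a b] by auto
    qed
  qed (use c col_less in auto)
  then show ?thesis using that by blast
qed

end

section \<open>Prime tournaments\<close>

text \<open>\<open>separated\<close> is primeness in positive form: \<open>x\<close> and
  \<open>y\<close> witness that \<open>X\<close> has two elements, and \<open>w\<close> has both an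
  out- and an in-neighbour in \<open>X\<close>.\<close>

locale prime_relation = tournament_relation +
  assumes separated: "X \<subset> V \<Longrightarrow> x \<in> X \<Longrightarrow> y \<in> X \<Longrightarrow> x \<noteq> y \<Longrightarrow>
    \<exists>w\<in>V - X. \<exists>a\<in>X. \<exists>b\<in>X. E w a \<and> E b w"
    and no_near_T5: "\<not> near_T5 E p q r s t"
begin

lemma near_T5D:
  assumes "E p q" "E q r" "E p r" "E s p" "E q s" "E r s" "E t p" "E t q" "E r t"
  shows False
  using no_near_T5 assms unfolding near_T5_def by blast

text \<open>A maximal strongly connected set \<open>M\<close> of vertices that dominate \<open>d\<close> and are dominated by \<open>e\<close> is not
  homogeneous, and a vertex \<open>w\<close> separating it either enlarges \<open>M\<close> or yields a copy of \<open>near_T5\<close>.\<close>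

lemma no_blown_triangle: "\<not> blown_triangle E a b c d e"
proof
  assume "blown_triangle E a b c d e"
  then have abc: "E a b" "E b c" "E c a" and de: "E d e"
    and abcd: "E a d" "E b d" "E c d" "E e a" "E e b" "E e c"
    by (auto simp: blown_triangle_def)
  have V: "a \<in> V" "b \<in> V" "c \<in> V" "d \<in> V"
    using abc abcd E_in_V by blast+
  define A where "A = {M. M \<subseteq> V \<and> strong E M \<and> (\<forall>x\<in>M. E x d \<and> E e x)}"
  have "finite A"
    unfolding A_def by (rule finite_subset[of _ "Pow V"]) (use finite_V in auto)
  moreover have "{a, b, c} \<in> A"
    using strong_triangle[of E a b c] abc V abcd by (simp add: A_def)
  ultimately obtain M where M: "M \<in> A" "{a, b, c} \<subseteq> M" and max: "\<forall>N\<in>A. M \<subseteq> N \<longrightarrow> M = N"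
    using finite_has_maximal2[of A "{a, b, c}"] by metis
  have M_props: "M \<subseteq> V" "strong E M" "\<And>x. x \<in> M \<Longrightarrow> E x d" "\<And>x. x \<in> M \<Longrightarrow> E e x"
    using M(1) by (simp_all add: A_def)
  have "d \<notin> M" using M_props(3)[of d] asym[of d d] by auto
  then have "M \<subset> V" using M_props(1) V(4) by auto
  moreover have "a \<in> M" "b \<in> M" "a \<noteq> b" using M(2) abc asym[of a b] by auto
  ultimately obtain w a' b' where w: "w \<in> V" "w \<notin> M" "a' \<in> M" "b' \<in> M" "E w a'" "E b' w"
    using separated[of M a b] by auto
  \<comment> \<open>A walk in \<open>M\<close> from an out-neighbour to an in-neighbour of
    \<open>w\<close> crosses over along an arc \<open>p -> q\<close>.\<close>
  obtain p q where pq: "p \<in> M" "q \<in> M" "E p q" "E w p" "\<not> E w q"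
    using strong_crossing[OF M_props(2) w(3,4), of "E w"] w(5) asym[OF w(6)] by metis
  have "w \<noteq> q" using w(2) pq(2) by auto
  then have qw: "E q w" using total[of w q] w(1) M_props(1) pq(2,5) by auto
  have M': "E p d" "E q d" "E e p" "E e q" using M_props(3,4) pq(1,2) by auto
  \<comment> \<open>An arc from \<open>d\<close> to \<open>w\<close>, and likewise one from
    \<open>w\<close> to \<open>e\<close>, completes a \<open>near_T5\<close> with \<open>p\<close>
    and \<open>q\<close>. Hence \<open>w\<close> meets the conditions for joining
    \<open>M\<close>.\<close>
  have "\<not> E d w"
    using near_T5D[of p q d w e] pq qw M' de by blast
  moreover have "w \<noteq> d" using asym[OF M'(1)] pq(4) by auto
  ultimately have wd: "E w d" using total[of w d] V w by blast
  have "\<not> E w e"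
    using near_T5D[of e p q d w] pq qw M' de by blast
  moreover have "w \<noteq> e" using asym[OF de] wd by auto
  moreover have "e \<in> V" using de E_in_V by blast
  ultimately have ew: "E e w" using total[of w e] w by blast
  have "insert w M \<in> A"
    using strong_insert[of E M a' b' w] M_props w wd ew by (simp add: A_def)
  then show False using max w(2) by blast
qed

text \<open>A cyclic triangle is a strong starting set with enough vertices for
  \<open>separated\<close> to apply to its maximal coloured enlargement. Without cyclic triangles a
  constant colouring is rainbow.\<close>

lemma rainbow_colouring: "\<exists>col. rainbow E V col"
proof (cases "\<exists>a b c. E a b \<and> E b c \<and> E c a")
  case False
  then have "rainbow E V (\<lambda>_. 0)"
    unfolding rainbow_def by (intro conjI ballI impI) (simp, blast)
  then show ?thesis by blast
next
  case True
  then obtain a b c where abc: "E a b" "E b c" "E c a" by blast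
  have V: "a \<in> V" "b \<in> V" "c \<in> V"
    using abc E_in_V by blast+
  have ne: "a \<noteq> b" "b \<noteq> c" "a \<noteq> c"
    using abc asym[of a b] asym[of b c] asym[of c a] by auto
  define A where "A = {S. S \<subseteq> V \<and> strong E S \<and> (\<exists>col. rainbow E S col)}"
  have "rainbow E {a, b, c} ((\<lambda>_. 0)(b := 1, c := 2))"
    unfolding rainbow_def using ne abc asym[of a a] asym[of b b] asym[of c c]
      asym[of a b] asym[of b c] asym[of c a] by auto
  then have "{a, b, c} \<in> A"
    using strong_triangle[of E a b c] abc V unfolding A_def by auto
  moreover have "finite A"
    unfolding A_def by (rule finite_subset[of _ "Pow V"]) (use finite_V in auto)
  ultimately obtain S where S: "S \<in> A" "{a, b, c} \<subseteq> S" and max: "\<forall>N\<in>A. S \<subseteq> N \<longrightarrow> S = N"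
    using finite_has_maximal2[of A "{a, b, c}"] by metis
  obtain col where S_props: "S \<subseteq> V" "strong E S" and col: "rainbow E S col"
    using S(1) unfolding A_def by auto
  have "S = V"
  proof (rule ccontr)
    assume "S \<noteq> V"
    then have "S \<subset> V" "a \<in> S" "b \<in> S" using S S_props by auto
    then obtain w a' b' where w: "w \<in> V" "w \<notin> S" "a' \<in> S" "b' \<in> S" "E w a'" "E b' w"
      using separated[of S a b] ne by auto
    interpret vertex_extension V E S col w
      by unfold_locales (use no_near_T5 no_blown_triangle S_props w col in auto)
    obtain k where "rainbow E (insert w S) (col(w := k))"
      by (rule extend_rainbow)
    then have "insert w S \<in> A"
      using strong_insert[of E S a' b' w] S_props w unfolding A_def by auto
    then show False using max w(2) by blast
  qed
  then show ?thesis using col by blast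
qed

end

section \<open>Transfer to digraphs\<close>

lemma (in tournament) tournament_relation: "tournament_relation (verts G) (\<lambda>u v. u \<rightarrow>\<^bsub>G\<^esub> v)"
proof
  fix u v
  show uv: "u \<in> verts G \<and> v \<in> verts G" if "u \<rightarrow>\<^bsub>G\<^esub> v"
    using adj_in_verts[OF that] by blast
  show "\<not> v \<rightarrow>\<^bsub>G\<^esub> u" if "u \<rightarrow>\<^bsub>G\<^esub> v"
    using exactly_one_arc[of u v] uv[OF that] that adj_not_same by blast
  show "u \<rightarrow>\<^bsub>G\<^esub> v \<or> v \<rightarrow>\<^bsub>G\<^esub> u" if "u \<in> verts G" "v \<in> verts G" "u \<noteq> v"
    using exactly_one_arc[OF that] by blast
qed simp

lemma adj_induce_subgraph_iff:
  "u \<rightarrow>\<^bsub>G \<restriction> S\<^esub> v \<longleftrightarrow> u \<rightarrow>\<^bsub>G\<^esub> v \<and> u \<in> S \<and> v \<in> S"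
  by (auto simp: arcs_ends_def arc_to_ends_def)

lemma transitive_set_iff:
  "transitive_set G S \<longleftrightarrow> S \<subseteq> verts G \<and>
     (\<forall>a\<in>S. \<forall>b\<in>S. \<forall>c\<in>S. \<not> (a \<rightarrow>\<^bsub>G\<^esub> b \<and> b \<rightarrow>\<^bsub>G\<^esub> c \<and> c \<rightarrow>\<^bsub>G\<^esub> a))"
  unfolding transitive_set_def adj_induce_subgraph_iff by blast

text \<open>The parts are the colour classes: a triangle fails to be rainbow exactly if two of the
  classes cover it.\<close>

lemma rainbow_iff_partition:
  "(\<exists>col. rainbow (\<lambda>u v. u \<rightarrow>\<^bsub>G\<^esub> v) (verts G) col) \<longleftrightarrow>
    (\<exists>X Y Z. X \<union> Y \<union> Z = verts G \<and> X \<inter> Y = {} \<and> Y \<inter> Z = {} \<and> Z \<inter> X = {} \<and>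
       transitive_set G (X \<union> Y) \<and> transitive_set G (Y \<union> Z) \<and> transitive_set G (Z \<union> X))"
  (is "?L \<longleftrightarrow> ?R")
proof
  assume ?L
  then obtain col where col: "rainbow (\<lambda>u v. u \<rightarrow>\<^bsub>G\<^esub> v) (verts G) col" ..
  let ?C = "\<lambda>k. {x \<in> verts G. col x = k}"
  have "\<forall>x\<in>verts G. col x = 0 \<or> col x = 1 \<or> col x = 2"
    using col unfolding rainbow_def by fastforce
  then have "?C 0 \<union> ?C 1 \<union> ?C 2 = verts G" by auto
  moreover have "transitive_set G (?C j \<union> ?C k)" for j k
  proof -
    have "distinct [col a, col b, col c]"
      if "a \<rightarrow>\<^bsub>G\<^esub> b \<and> b \<rightarrow>\<^bsub>G\<^esub> c \<and> c \<rightarrow>\<^bsub>G\<^esub> a" "a \<in> verts G" "b \<in> verts G" "c \<in> verts G" for a b c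
      using col that unfolding rainbow_def by blast
    then show ?thesis
      unfolding transitive_set_iff by fastforce
  qed
  ultimately show ?R
    by (intro exI[of _ "?C 0"] exI[of _ "?C 1"] exI[of _ "?C 2"] conjI) (assumption | auto)+
next
  assume ?R
  then obtain X Y Z where XYZ: "X \<union> Y \<union> Z = verts G" "X \<inter> Y = {}" "Y \<inter> Z = {}" "Z \<inter> X = {}"
    "transitive_set G (X \<union> Y)" "transitive_set G (Y \<union> Z)" "transitive_set G (Z \<union> X)" by blast
  define col :: "'a \<Rightarrow> nat" where "col x = (if x \<in> X then 0 else if x \<in> Y then 1 else 2)" for x
  have "rainbow (\<lambda>u v. u \<rightarrow>\<^bsub>G\<^esub> v) (verts G) col"
    unfolding rainbow_def
  proof (intro conjI ballI impI)
    fix a b c assume abc: "a \<in> verts G" "b \<in> verts G" "c \<in> verts G"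
      "a \<rightarrow>\<^bsub>G\<^esub> b \<and> b \<rightarrow>\<^bsub>G\<^esub> c \<and> c \<rightarrow>\<^bsub>G\<^esub> a"
    have "\<not> (a \<in> S \<and> b \<in> S \<and> c \<in> S)" if "transitive_set G S" for S
      using that abc(4) unfolding transitive_set_iff by metis
    then have "\<not> (a \<in> X \<union> Y \<and> b \<in> X \<union> Y \<and> c \<in> X \<union> Y)"
      "\<not> (a \<in> Y \<union> Z \<and> b \<in> Y \<union> Z \<and> c \<in> Y \<union> Z)" "\<not> (a \<in> Z \<union> X \<and> b \<in> Z \<union> X \<and> c \<in> Z \<union> X)"
      using XYZ(5-7) by blast+
    then show "distinct [col a, col b, col c]"
      using abc(1-3) unfolding XYZ(1)[symmetric] Un_iff col_def by (simp split: if_split) blast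
  qed (simp add: col_def)
  then show ?L by blast
qed

section \<open>Induced copies of \<open>T5\<close> and \<open>U5\<close>\<close>

text \<open>Between tournaments, an injective map that preserves arcs also reflects them, so its
  image induces a copy of \<open>H\<close>.\<close>

lemma (in tournament) contains_copy_iff:
  fixes H :: "('c, 'c \<times> 'c) pre_digraph"
  assumes H: "tournament H" "tail H = fst" "head H = snd"
  shows "\<not> free_of H G \<longleftrightarrow>
    (\<exists>f. f ` verts H \<subseteq> verts G \<and> inj_on f (verts H) \<and> (\<forall>(i, j)\<in>arcs H. f i \<rightarrow>\<^bsub>G\<^esub> f j))"
    (is "?L \<longleftrightarrow> ?R")
proof
  interpret H: tournament H by (rule H)
  assume ?L
  then obtain G' h where G': "induced_subgraph G' G" and h: "pre_digraph.digraph_isomorphism G' h"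
    and H_eq: "H = app_iso h G'"
    unfolding free_of_def digraph_iso_def by blast
  define f where "f = the_inv_into (verts G') (iso_verts h)"
  have inj: "inj_on (iso_verts h) (verts G')"
    using h by (simp add: pre_digraph.digraph_isomorphism_def)
  have sub: "subgraph G' G" using G' by blast
  then have V: "verts G' \<subseteq> verts G" "arcs G' \<subseteq> arcs G" "tail G' = tail G" "head G' = head G"
    by (auto simp: subgraph_def compatible_def)
  have bij: "bij_betw f (verts H) (verts G')"
    unfolding f_def H_eq by (simp add: bij_betw_the_inv_into inj bij_betw_imageI)
  have "f i \<rightarrow>\<^bsub>G\<^esub> f j" if "(i, j) \<in> arcs H" for i j
  proof -
    have "(i, j) \<in> iso_arcs h ` arcs G'"
      using that unfolding H_eq by simp
    then obtain e where e: "e \<in> arcs G'" "iso_arcs h e = (i, j)"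
      by (metis imageE)
    have "iso_tail h = fst" "iso_head h = snd"
      using H(2,3) unfolding H_eq by simp_all
    then have "iso_verts h (tail G' e) = i" "iso_verts h (head G' e) = j"
      using h e by (simp_all add: pre_digraph.digraph_isomorphism_def)
    moreover have "tail G' e \<in> verts G'" "head G' e \<in> verts G'"
      using h e by (auto simp: pre_digraph.digraph_isomorphism_def wf_digraph_def)
    ultimately have "f i = tail G e" "f j = head G e"
      unfolding f_def using the_inv_into_f_f[OF inj] V by auto
    then show ?thesis
      using e V by (auto simp: arcs_ends_def arc_to_ends_def)
  qed
  then show ?R
    using bij V by (intro exI[of _ f]) (auto simp: bij_betw_def)
next
  interpret H: tournament H by (rule H)
  assume ?R
  then obtain f where f: "f ` verts H \<subseteq> verts G" "inj_on f (verts H)"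
    "\<And>i j. (i, j) \<in> arcs H \<Longrightarrow> f i \<rightarrow>\<^bsub>G\<^esub> f j" by blast
  let ?G' = "G \<restriction> (f ` verts H)"
  define g where "g = the_inv_into (verts H) f"
  have g: "g (f i) = i" if "i \<in> verts H" for i
    unfolding g_def using the_inv_into_f_f[OF f(2) that] .
  have arcs_H: "(i, j) \<in> arcs H \<longleftrightarrow> i \<rightarrow>\<^bsub>H\<^esub> j" for i j
    using H(2,3) by (force simp: arcs_ends_def arc_to_ends_def)
  have refl: "i \<rightarrow>\<^bsub>H\<^esub> j" if "f i \<rightarrow>\<^bsub>G\<^esub> f j" "i \<in> verts H" "j \<in> verts H" for i j
  proof (rule ccontr)
    assume "\<not> i \<rightarrow>\<^bsub>H\<^esub> j"
    moreover have "f i \<noteq> f j" using adj_not_same that(1) by auto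
    ultimately have "f j \<rightarrow>\<^bsub>G\<^esub> f i"
      using H.exactly_one_arc[of i j] that f(3) arcs_H by blast
    then show False
      using exactly_one_arc[of "f i" "f j"] adj_in_verts[OF that(1)] \<open>f i \<noteq> f j\<close> that(1) by blast
  qed
  \<comment> \<open>Arcs of \<open>H\<close> are pairs, so each arc goes to the pair of its
    relabelled ends; this makes the image of \<open>?G'\<close> equal to \<open>H\<close>, as
    \<open>digraph_iso\<close> demands.\<close>
  define h where "h = \<lparr>iso_verts = g, iso_arcs = (\<lambda>e. (g (tail G e), g (head G e))),
    iso_head = snd, iso_tail = fst\<rparr>"
  have ind: "induced_subgraph ?G' G"
    using f(1) by (rule induced_induce)
  have "inj_on g (f ` verts H)"
    by (rule inj_onI) (use g in auto)
  moreover have "inj_on (\<lambda>e. (g (tail G e), g (head G e))) (arcs ?G')"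
  proof (rule inj_onI)
    fix e e' assume *: "e \<in> arcs ?G'" "e' \<in> arcs ?G'"
      "(g (tail G e), g (head G e)) = (g (tail G e'), g (head G e'))"
    then have "tail G e = tail G e'" "head G e = head G e'"
      using g by auto
    then show "e = e'"
      using * no_multi_arcs by (auto simp: arc_to_ends_def)
  qed
  ultimately have "pre_digraph.digraph_isomorphism ?G' h"
    using wellformed_induce_subgraph
    by (simp add: pre_digraph.digraph_isomorphism_def h_def)
  moreover have "H = app_iso h ?G'"
  proof (rule pre_digraph.equality)
    show "verts H = verts (app_iso h ?G')"
      using g by (auto simp: h_def image_image)
    show "arcs H = arcs (app_iso h ?G')"
    proof (intro equalityI subsetI)
      fix x assume "x \<in> arcs H"
      then obtain i j where x: "x = (i, j)" "(i, j) \<in> arcs H" by (cases x) auto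
      then have ij: "i \<in> verts H" "j \<in> verts H" using arcs_H H.adj_in_verts by blast+
      obtain e where "e \<in> arcs G" "tail G e = f i" "head G e = f j"
        using f(3)[OF x(2)] by (auto simp: arcs_ends_def arc_to_ends_def)
      then show "x \<in> arcs (app_iso h ?G')"
        using x ij g by (auto simp: h_def intro!: image_eqI[of _ _ e])
    next
      fix x assume "x \<in> arcs (app_iso h ?G')"
      then obtain e i j where e: "e \<in> arcs G" "i \<in> verts H" "j \<in> verts H" "tail G e = f i" "head G e = f j"
        and x: "x = (g (f i), g (f j))"
        by (auto simp: h_def)
      then have "f i \<rightarrow>\<^bsub>G\<^esub> f j"
        by (force simp: arcs_ends_def arc_to_ends_def)
      then show "x \<in> arcs H"
        using refl e x g arcs_H by simp
    qed
  qed (simp_all add: h_def H)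
  ultimately show ?L
    unfolding free_of_def digraph_iso_def using ind by blast
qed

text \<open>The arc between 1 and 2 comes last; the other nine conjuncts agree with those for
  \<open>U5\<close>.\<close>

lemma ball_arcs_T5:
  "(\<forall>(i, j)\<in>arcs T5. P i j) \<longleftrightarrow>
    P 1 3 \<and> P 2 3 \<and> P 2 4 \<and> P 3 4 \<and> P 3 5 \<and> P 4 5 \<and> P 4 1 \<and> P 5 1 \<and> P 5 2 \<and> P 1 2"
proof -
  have "(\<forall>(i, j)\<in>arcs T5. P i j) \<longleftrightarrow> (\<forall>i\<in>{1, 2, 3, 4, 5}. \<forall>j\<in>{1, 2, 3, 4, 5}.
      [j - i = 1] (mod 5) \<or> [j - i = 2] (mod 5) \<longrightarrow> P i j)"
    unfolding T5_def with_proj_simps pair_pre_digraph.simps atLeastAtMost_1_5 by blast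
  then show ?thesis
    by (simp add: cong_def) blast
qed

lemma ball_arcs_U5:
  "(\<forall>(i, j)\<in>arcs U5. P i j) \<longleftrightarrow>
    P 1 3 \<and> P 2 3 \<and> P 2 4 \<and> P 3 4 \<and> P 3 5 \<and> P 4 5 \<and> P 4 1 \<and> P 5 1 \<and> P 5 2 \<and> P 2 1"
proof -
  have "(\<forall>(i, j)\<in>arcs U5. P i j) \<longleftrightarrow> P 2 1 \<and> (\<forall>i\<in>{1, 2, 3, 4, 5}. \<forall>j\<in>{1, 2, 3, 4, 5}.
      ([j - i = 1] (mod 5) \<or> [j - i = 2] (mod 5)) \<and> {i, j} \<noteq> {1, 2} \<longrightarrow> P i j)"
    unfolding U5_def with_proj_simps pair_pre_digraph.simps atLeastAtMost_1_5 by blast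
  then show ?thesis
    by (simp add: cong_def doubleton_eq_iff) blast
qed

lemma verts_T5: "verts T5 = {1, 2, 3, 4, 5}" and verts_U5: "verts U5 = {1, 2, 3, 4, 5}"
  by (simp_all add: T5_def U5_def atLeastAtMost_1_5)

text \<open>The arc that \<open>near_T5\<close> leaves open is present in one of its two directions;
  one gives \<open>T5\<close>, the other \<open>U5\<close>.\<close>

lemma (in tournament) free_of_T5_U5_iff:
  "free_of T5 G \<and> free_of U5 G \<longleftrightarrow> (\<nexists>p q r s t. near_T5 (\<lambda>u v. u \<rightarrow>\<^bsub>G\<^esub> v) p q r s t)"
proof -
  interpret R: tournament_relation "verts G" "\<lambda>u v. u \<rightarrow>\<^bsub>G\<^esub> v"
    by (rule tournament_relation)
  have proj: "tail T5 = fst" "head T5 = snd" "tail U5 = fst" "head U5 = snd"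
    by (simp_all add: T5_def U5_def)
  note T5 = contains_copy_iff[OF tournament_T5 proj(1,2)] and U5 = contains_copy_iff[OF tournament_U5 proj(3,4)]
  have "\<not> free_of T5 G \<or> \<not> free_of U5 G" if near: "near_T5 (\<lambda>u v. u \<rightarrow>\<^bsub>G\<^esub> v) p q r s t" for p q r s t
  proof -
    have e: "p \<rightarrow>\<^bsub>G\<^esub> q" "q \<rightarrow>\<^bsub>G\<^esub> r" "p \<rightarrow>\<^bsub>G\<^esub> r" "s \<rightarrow>\<^bsub>G\<^esub> p" "q \<rightarrow>\<^bsub>G\<^esub> s" "r \<rightarrow>\<^bsub>G\<^esub> s"
      "t \<rightarrow>\<^bsub>G\<^esub> p" "t \<rightarrow>\<^bsub>G\<^esub> q" "r \<rightarrow>\<^bsub>G\<^esub> t"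
      using near by (auto simp: near_T5_def)
    have ne: "distinct [p, q, r, s, t]"
      using e R.asym by (metis distinct_length_2_or_more distinct_singleton)
    have V: "p \<in> verts G" "q \<in> verts G" "r \<in> verts G" "s \<in> verts G" "t \<in> verts G"
      using e adj_in_verts by blast+
    \<comment> \<open>The default value \<open>p\<close> is the image of 3.\<close>
    define f :: "int \<Rightarrow> 'a" where "f = (\<lambda>_. p)(1 := s, 2 := t, 4 := q, 5 := r)"
    have fV: "f ` {1, 2, 3, 4, 5} \<subseteq> verts G" "inj_on f {1, 2, 3, 4, 5}"
      using V ne by (auto simp: f_def)
    have "s \<rightarrow>\<^bsub>G\<^esub> t \<or> t \<rightarrow>\<^bsub>G\<^esub> s"
      using R.total[of s t] V ne by auto
    then have "(\<forall>(i, j)\<in>arcs T5. f i \<rightarrow>\<^bsub>G\<^esub> f j) \<or> (\<forall>(i, j)\<in>arcs U5. f i \<rightarrow>\<^bsub>G\<^esub> f j)"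
      using e unfolding ball_arcs_T5 ball_arcs_U5 by (simp add: f_def)
    then show ?thesis
      unfolding T5 U5 verts_T5 verts_U5 using fV by blast
  qed
  moreover have "\<exists>p q r s t. near_T5 (\<lambda>u v. u \<rightarrow>\<^bsub>G\<^esub> v) p q r s t" if "\<not> free_of T5 G \<or> \<not> free_of U5 G"
  proof -
    from that obtain f :: "int \<Rightarrow> 'a"
      where "(\<forall>(i, j)\<in>arcs T5. f i \<rightarrow>\<^bsub>G\<^esub> f j) \<or> (\<forall>(i, j)\<in>arcs U5. f i \<rightarrow>\<^bsub>G\<^esub> f j)"
      unfolding T5 U5 by blast
    then have "near_T5 (\<lambda>u v. u \<rightarrow>\<^bsub>G\<^esub> v) (f 3) (f 4) (f 5) (f 1) (f 2)"
      unfolding ball_arcs_T5 ball_arcs_U5 near_T5_def by auto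
    then show ?thesis by blast
  qed
  ultimately show ?thesis by blast
qed

section \<open>The equivalence for prime tournaments\<close>

lemma prime_relation_of_prime_tournament:
  assumes G: "prime_tournament G" and "\<And>p q r s t. \<not> near_T5 (\<lambda>u v. u \<rightarrow>\<^bsub>G\<^esub> v) p q r s t"
  shows "prime_relation (verts G) (\<lambda>u v. u \<rightarrow>\<^bsub>G\<^esub> v)"
proof -
  interpret tournament G using G by (simp add: prime_tournament_def)
  interpret tournament_relation "verts G" "\<lambda>u v. u \<rightarrow>\<^bsub>G\<^esub> v" by (rule tournament_relation)
  show ?thesis
  proof
    fix X x y assume X: "X \<subset> verts G" "x \<in> X" "y \<in> X" "x \<noteq> y"
    have "finite X" using X finite_verts finite_subset by blast
    then have "card {x, y} \<le> card X"
      using X by (intro card_mono) auto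
    then have "1 < card X" using X by simp
    moreover have "card X < card (verts G)"
      using X by (simp add: psubset_card_mono)
    ultimately have "\<not> homogeneous_set G X"
      using G unfolding prime_tournament_def nontrivial_homogeneous_set_def by blast
    \<comment> \<open>Failure of homogeneity gives two missing arcs at \<open>w\<close>, which
      totality turns into arcs of the opposite direction.\<close>
    then obtain w a b where w: "w \<in> verts G - X" "a \<in> X" "\<not> w \<rightarrow>\<^bsub>G\<^esub> a" "b \<in> X" "\<not> b \<rightarrow>\<^bsub>G\<^esub> w"
      using X unfolding homogeneous_set_def by blast
    then have "a \<rightarrow>\<^bsub>G\<^esub> w" "w \<rightarrow>\<^bsub>G\<^esub> b"
      using total[of w a] total[of w b] X by auto
    then show "\<exists>w\<in>verts G - X. \<exists>a\<in>X. \<exists>b\<in>X. w \<rightarrow>\<^bsub>G\<^esub> a \<and> b \<rightarrow>\<^bsub>G\<^esub> w"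
      using w by blast
  qed (use assms in blast)
qed

theorem theorem2p5:
  fixes G :: "('a, 'b) pre_digraph"
  assumes "prime_tournament G"
  shows "free_of T5 G \<and> free_of U5 G \<longleftrightarrow>
    (\<exists>X Y Z. X \<union> Y \<union> Z = verts G \<and> X \<inter> Y = {} \<and> Y \<inter> Z = {} \<and> Z \<inter> X = {} \<and>
       transitive_set G (X \<union> Y) \<and> transitive_set G (Y \<union> Z) \<and> transitive_set G (Z \<union> X))"
proof -
  interpret tournament G using assms by (simp add: prime_tournament_def)
  \<comment> \<open>After rewriting, the claim is that \<open>near_T5\<close> is absent if and only
    if a rainbow colouring exists.\<close>
  show ?thesis
    unfolding free_of_T5_U5_iff rainbow_iff_partition[symmetric]
  proof
    assume "\<nexists>p q r s t. near_T5 (\<lambda>u v. u \<rightarrow>\<^bsub>G\<^esub> v) p q r s t"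
    then have "prime_relation (verts G) (\<lambda>u v. u \<rightarrow>\<^bsub>G\<^esub> v)"
      by (intro prime_relation_of_prime_tournament[OF assms]) simp
    then show "\<exists>col. rainbow (\<lambda>u v. u \<rightarrow>\<^bsub>G\<^esub> v) (verts G) col"
      by (rule prime_relation.rainbow_colouring)
  next
    assume "\<exists>col. rainbow (\<lambda>u v. u \<rightarrow>\<^bsub>G\<^esub> v) (verts G) col"
    then show "\<nexists>p q r s t. near_T5 (\<lambda>u v. u \<rightarrow>\<^bsub>G\<^esub> v) p q r s t"
      using tournament_relation.rainbow_imp_no_near_T5[OF tournament_relation] by metis
  qed
qed

end
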